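(* Let $\mathcal{H}$ be a complex separable Hilbert space, let $T\in B(\mathcal{H})$ be a $2$-isometry, and let $u,v\in\mathcal{H}$ be nonzero vectors with $\|v\|=1$. Let $K=u\otimes v$, let $$S:=\{x\in\ker K : Tx\in\ker K\},$$ and let $\widetilde{T}:=T+K$. Then $\widetilde{T}$ is a $2$-isometry if and only if $v\in\ker\Delta_2(\widetilde{T})$ and exactly one of the following conditions (i), (ii) holds: (i) $S=\ker K$, i.e. $\ker K$ is an invariant subspace of $T$. (ii) Both of the following are satisfied: (a) $\Delta_2(\widetilde{T})(S)\subseteq S$ (equivalently, given $v\in\ker\Delta_2(\widetilde{T})$, $\Delta_2(\widetilde{T})(S^\perp\cap\ker K)\subseteq S^\perp\cap\ker K$); (b) $S^\perp\cap\ker K\neq\{0\}$ and $\|u\|^2=-2\big(\gamma+\operatorname{Re}\langle u,Tv\rangle\big)$, where $\gamma\in\mathbb{R}$ is given by $$\gamma=\operatorname{Re}\left(\frac{\langle T^*P_{\ker K}T^*u,\,x\rangle}{\langle T^*v,\,x\rangle}\right)$$ for $x\in(S^\perp\cap\ker K)\setminus\{0\}$.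
   Context: $B(\mathcal{H})$ is the algebra of bounded linear operators on $\mathcal{H}$; the inner product is linear in the first argument. For $T\in B(\mathcal{H})$ put $\Delta_2(T):=I-2T^*T+T^{*2}T^2$; $T$ is called a $2$-isometry if $\Delta_2(T)=0$. For $u,v\in\mathcal{H}$, the operator $u\otimes v$ is defined by $(u\otimes v)(x)=\langle x,v\rangle u$. A closed subspace $U$ is invariant under $T$ if $T(U)\subseteq U$. $P_{\ker K}$ is the orthogonal projection onto $\ker K$, and $\operatorname{Re}$ denotes real part. If $S\neq\ker K$, then $S^\perp\cap\ker K$ is one-dimensional and $\langle T^*v,x\rangle\neq 0$ for every nonzero $x$ in it, so that $\gamma$ is well defined and does not depend on the choice of $x$. *)

theory Defs
  imports "HOL-Analysis.Analysis"
begin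

section \<open>Complex Hilbert spaces\<close>

class complex_vector = real_vector +
  fixes scaleC :: "complex \<Rightarrow> 'a \<Rightarrow> 'a"  (infixr \<open>*\<^sub>C\<close> 75)
  assumes scaleC_add_right: "a *\<^sub>C (x + y) = a *\<^sub>C x + a *\<^sub>C y"
    and scaleC_add_left: "(a + b) *\<^sub>C x = a *\<^sub>C x + b *\<^sub>C x"
    and scaleC_scaleC: "a *\<^sub>C (b *\<^sub>C x) = (a * b) *\<^sub>C x"
    and scaleC_one: "1 *\<^sub>C x = x"
    and scaleR_scaleC: "r *\<^sub>R x = complex_of_real r *\<^sub>C x"

text \<open>The inner product is linear in the first argument.  Since \<open>norm x = sqrt (inner x x)\<close> in
  \<^class>\<open>real_inner\<close>, the axiom \<open>inner_eq_Re_cinner\<close> says that the norm is the one induced by the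
  complex inner product; positive definiteness is inherited in the same way.\<close>

class complex_inner = complex_vector + real_inner +
  fixes cinner :: "'a \<Rightarrow> 'a \<Rightarrow> complex"
  assumes cinner_commute: "cinner x y = cnj (cinner y x)"
    and cinner_add_left: "cinner (x + y) z = cinner x z + cinner y z"
    and cinner_scaleC_left: "cinner (c *\<^sub>C x) y = c * cinner x y"
    and inner_eq_Re_cinner: "inner x y = Re (cinner x y)"

class complex_hilbert_space = complex_inner + complete_space

subclass (in complex_hilbert_space) banach ..

instantiation complex :: complex_hilbert_space
begin

definition scaleC_complex :: "complex \<Rightarrow> complex \<Rightarrow> complex" where
  "scaleC_complex c x = c * x"

definition cinner_complex :: "complex \<Rightarrow> complex \<Rightarrow> complex" where
  "cinner_complex x y = x * cnj y"

instance
  by standard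
    (simp_all add: scaleC_complex_def cinner_complex_def algebra_simps inner_complex_def
      scaleR_conv_of_real)

end

lemma norm_scaleC:
  fixes x :: "'a::complex_inner"
  shows "norm (c *\<^sub>C x) = cmod c * norm x"
proof -
  have right: "cinner x (c *\<^sub>C x) = cnj c * cinner x x"
    by (metis cinner_commute cinner_scaleC_left complex_cnj_mult)
  have "cinner (c *\<^sub>C x) (c *\<^sub>C x) = (c * cnj c) * cinner x x"
    by (simp add: cinner_scaleC_left right)
  also have "c * cnj c = complex_of_real ((cmod c)\<^sup>2)"
    by (rule complex_norm_square [symmetric])
  finally have "inner (c *\<^sub>C x) (c *\<^sub>C x) = (cmod c)\<^sup>2 * inner x x"
    by (simp add: inner_eq_Re_cinner)
  then show ?thesis
    by (simp add: norm_eq_sqrt_inner real_sqrt_mult)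
qed

lemma norm_cinner_le:
  fixes x y :: "'a::complex_inner"
  shows "cmod (cinner x y) \<le> norm x * norm y"
proof (cases "cinner x y = 0")
  case False
  define c where "c = cnj (cinner x y) / cmod (cinner x y)"
  have "cmod c = 1"
    using False by (simp add: c_def norm_divide)
  have "c * cinner x y = complex_of_real (cmod (cinner x y))"
    using False complex_norm_square [of "cinner x y"]
    by (simp add: c_def field_simps power2_eq_square)
  then have "inner (c *\<^sub>C x) y = cmod (cinner x y)"
    by (simp add: inner_eq_Re_cinner cinner_scaleC_left)
  also have "inner (c *\<^sub>C x) y \<le> norm (c *\<^sub>C x) * norm y"
    by (rule norm_cauchy_schwarz)
  ultimately show ?thesis
    using \<open>cmod c = 1\<close> by (simp add: norm_scaleC)
qed simp

section \<open>Operators\<close>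

text \<open>\<open>B(H)\<close> consists of those elements of the library type \<open>'a \<Rightarrow>\<^sub>L 'a\<close> (whose elements are only
  real-linear) that commute with complex scalars.\<close>

definition complex_linear :: "('a::complex_inner \<Rightarrow>\<^sub>L 'a) \<Rightarrow> bool" where
  "complex_linear T \<longleftrightarrow> (\<forall>c x. T (c *\<^sub>C x) = c *\<^sub>C T x)"

text \<open>Only meaningful if \<open>T\<close> is complex-linear on a Hilbert space; then the adjoint exists.\<close>

definition cadj :: "('a::complex_inner \<Rightarrow>\<^sub>L 'a) \<Rightarrow> ('a \<Rightarrow>\<^sub>L 'a)" where
  "cadj T = (THE A :: 'a \<Rightarrow>\<^sub>L 'a. \<forall>x y. cinner (T x) y = cinner x (A y))"

definition Delta2 :: "('a::complex_inner \<Rightarrow>\<^sub>L 'a) \<Rightarrow> ('a \<Rightarrow>\<^sub>L 'a)" where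
  "Delta2 T = id_blinfun - 2 *\<^sub>R (cadj T o\<^sub>L T) + ((cadj T o\<^sub>L cadj T) o\<^sub>L (T o\<^sub>L T))"

definition two_isometry :: "('a::complex_inner \<Rightarrow>\<^sub>L 'a) \<Rightarrow> bool" where
  "two_isometry T \<longleftrightarrow> Delta2 T = 0"

lift_definition rank_one :: "'a::complex_inner \<Rightarrow> 'a \<Rightarrow> ('a \<Rightarrow>\<^sub>L 'a)"
  is "\<lambda>u v x. cinner x v *\<^sub>C u"
proof (rule bounded_linear_intro)
  fix u v x y :: 'a and r :: real
  show "cinner (x + y) v *\<^sub>C u = cinner x v *\<^sub>C u + cinner y v *\<^sub>C u"
    by (simp add: cinner_add_left scaleC_add_left)
  show "cinner (r *\<^sub>R x) v *\<^sub>C u = r *\<^sub>R (cinner x v *\<^sub>C u)"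
    by (simp add: scaleR_scaleC cinner_scaleC_left scaleC_scaleC)
  have "norm (cinner x v *\<^sub>C u) \<le> (norm x * norm v) * norm u"
    unfolding norm_scaleC by (intro mult_right_mono norm_cinner_le norm_ge_zero)
  then show "norm (cinner x v *\<^sub>C u) \<le> norm x * (norm v * norm u)"
    by (simp add: mult.assoc)
qed

definition op_ker :: "('a::complex_inner \<Rightarrow>\<^sub>L 'a) \<Rightarrow> 'a set" where
  "op_ker T = {x. T x = 0}"

text \<open>The library's \<^const>\<open>orthogonal_comp\<close> refers to the real inner product.\<close>

definition corth_comp :: "'a::complex_inner set \<Rightarrow> 'a set" where
  "corth_comp M = {x. \<forall>y\<in>M. cinner x y = 0}"

text \<open>Orthogonal projection onto a closed subspace \<open>M\<close> of a Hilbert space.\<close>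

definition cproj :: "'a::complex_inner set \<Rightarrow> 'a \<Rightarrow> 'a" where
  "cproj M x = (THE y. y \<in> M \<and> x - y \<in> corth_comp M)"

definition S_space :: "('a::complex_inner \<Rightarrow>\<^sub>L 'a) \<Rightarrow> ('a \<Rightarrow>\<^sub>L 'a) \<Rightarrow> 'a set" where
  "S_space T K = {x \<in> op_ker K. T x \<in> op_ker K}"

text \<open>The common value of the quotient over all admissible \<open>x\<close>.  If \<open>T\<close> is complex-linear and
  \<open>S_space T K\<close> differs from \<open>op_ker K\<close>, where \<open>K = rank_one u v\<close>, then the space over which \<open>x\<close>
  ranges is one-dimensional and the denominator does not vanish at nonzero \<open>x\<close>, so the value is
  unique; otherwise there is no admissible \<open>x\<close> and the term is unspecified.\<close>

definition gamma_coeff :: "('a::complex_inner \<Rightarrow>\<^sub>L 'a) \<Rightarrow> 'a \<Rightarrow> 'a \<Rightarrow> real" where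
  "gamma_coeff T u v =
    (let K = rank_one u v; S = S_space T K in
      THE \<gamma>. \<forall>x \<in> (corth_comp S \<inter> op_ker K) - {0}.
        \<gamma> = Re (cinner (cadj T (cproj (op_ker K) (cadj T u))) x / cinner (cadj T v) x))"

definition exactly_one :: "bool \<Rightarrow> bool \<Rightarrow> bool" where
  "exactly_one P Q \<longleftrightarrow> (P \<and> \<not> Q) \<or> (\<not> P \<and> Q)"

end

theory Submission
  imports Defs
begin

text \<open>
  The form \<open>\<langle>\<Delta>\<^sub>2(T') x, y\<rangle>\<close> is Hermitian, and on \<open>ker K = v\<^sup>\<bottom>\<close> all terms coming from \<open>T\<close> alone
  cancel; with \<open>w = T\<^sup>*v\<close> and \<open>a = T\<^sup>*\<^sup>2u\<close> what remains is
  \<open>\<langle>x,a\<rangle>\<langle>w,y\<rangle> + \<langle>x,w\<rangle>\<langle>a,y\<rangle> + \<parallel>u\<parallel>\<^sup>2\<langle>x,w\<rangle>\<langle>w,y\<rangle>\<close>.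
  It vanishes on \<open>S = {v,w}\<^sup>\<bottom>\<close>, and the orthogonal complement of \<open>S\<close> in \<open>ker K\<close> is spanned by the
  component \<open>w\<^sub>0\<close> of \<open>w\<close> orthogonal to \<open>v\<close>.  Hence, once \<open>\<Delta>\<^sub>2(T') v = 0\<close>, the form vanishes iff it
  vanishes on \<open>S \<times> {w\<^sub>0}\<close>, which is (a), and at \<open>(w\<^sub>0,w\<^sub>0)\<close>, which is the norm identity in (b).
\<close>

section \<open>Complex inner products\<close>

lemma cinner_add_right: "cinner x (y + z) = cinner x y + cinner x z"
  for x :: "'a::complex_inner"
  by (metis cinner_add_left cinner_commute complex_cnj_add)

lemma cinner_scaleC_right: "cinner x (c *\<^sub>C y) = cnj c * cinner x y"
  for x :: "'a::complex_inner"
  by (metis cinner_commute cinner_scaleC_left complex_cnj_mult)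

lemma cinner_scaleR_left: "cinner (r *\<^sub>R x) y = of_real r * cinner x y"
  for x :: "'a::complex_inner"
  by (simp add: scaleR_scaleC cinner_scaleC_left)

lemma cinner_scaleR_right: "cinner x (r *\<^sub>R y) = of_real r * cinner x y"
  for x :: "'a::complex_inner"
  by (simp add: scaleR_scaleC cinner_scaleC_right)

lemma cinner_zero_left [simp]: "cinner 0 y = 0"
  for y :: "'a::complex_inner"
  using cinner_scaleR_left [of 0 0 y] by simp

lemma cinner_zero_right [simp]: "cinner x 0 = 0"
  for x :: "'a::complex_inner"
  using cinner_scaleR_right [of x 0 0] by simp

lemma cinner_diff_left: "cinner (x - y) z = cinner x z - cinner y z"
  for x :: "'a::complex_inner"
  by (metis add_diff_cancel_right' cinner_add_left diff_add_cancel)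

lemma cinner_diff_right: "cinner x (y - z) = cinner x y - cinner x z"
  for x :: "'a::complex_inner"
  by (metis add_diff_cancel_right' cinner_add_right diff_add_cancel)

lemma cinner_self: "cinner x x = of_real ((norm x)\<^sup>2)"
  for x :: "'a::complex_inner"
proof (rule complex_eqI)
  have "cinner x x = cnj (cinner x x)"
    by (rule cinner_commute)
  then show "Im (cinner x x) = Im (of_real ((norm x)\<^sup>2))"
    by (simp add: complex_eq_iff)
  show "Re (cinner x x) = Re (of_real ((norm x)\<^sup>2))"
    by (metis Re_complex_of_real inner_eq_Re_cinner power2_norm_eq_inner)
qed

lemma cinner_self_eq_0 [simp]: "cinner x x = 0 \<longleftrightarrow> x = 0"
  for x :: "'a::complex_inner"
  by (simp add: cinner_self)

lemma cinner_eq_0_commute: "cinner x y = 0 \<longleftrightarrow> cinner y x = 0"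
  for x :: "'a::complex_inner"
  by (metis cinner_commute complex_cnj_zero)

text \<open>Recovers the complex form from the real one, so that real identities tested at
  \<open>x\<close> and at \<open>\<i> *\<^sub>C x\<close> lift to \<open>cinner\<close>.\<close>

lemma cinner_eq_inner: "cinner x y = Complex (inner x y) (- inner (\<i> *\<^sub>C x) y)"
  for x :: "'a::complex_inner"
  by (simp add: complex_eq_iff inner_eq_Re_cinner cinner_scaleC_left)

lemma cinner_eqI_right:
  fixes x y :: "'a::complex_inner"
  assumes "\<And>z. cinner z x = cinner z y"
  shows "x = y"
  by (metis assms cinner_diff_right cinner_self_eq_0 right_minus_eq)

lemma scaleC_zero_left [simp]: "0 *\<^sub>C x = 0"
  for x :: "'a::complex_inner"
  by (metis mult_zero_left norm_scaleC norm_zero norm_eq_zero)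

section \<open>Riesz representation and adjoints\<close>

text \<open>The representing vector minimises \<open>\<parallel>x\<parallel>\<^sup>2 - 2 f x\<close>; minimising sequences are Cauchy by the
  parallelogram law.\<close>

lemma riesz_representation:
  fixes f :: "'a::{real_inner, complete_space} \<Rightarrow> real"
  assumes "bounded_linear f"
  shows "\<exists>z. \<forall>x. f x = inner z x"
proof -
  interpret f: bounded_linear f by fact
  define q where "q x = (norm x)\<^sup>2 - 2 * f x" for x
  define m where "m = Inf (range q)"
  obtain B where B: "\<And>x. norm (f x) \<le> norm x * B"
    using f.bounded by blast
  have "- B\<^sup>2 \<le> q x" for x
  proof -
    have "0 \<le> (norm x - B)\<^sup>2" by simp
    then show ?thesis
      using B [of x] by (simp add: q_def power2_diff)
  qed
  then have bdd: "bdd_below (range q)"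
    by (intro bdd_belowI [of _ "- B\<^sup>2"]) auto
  have m_le: "m \<le> q x" for x
    unfolding m_def using bdd by (intro cInf_lower) auto
  have "\<exists>x. q x < m + 1 / real (Suc n)" for n
    using cInf_lessD [of "range q" "m + 1 / real (Suc n)"] by (auto simp: m_def)
  then obtain X where X: "\<And>n. q (X n) < m + 1 / real (Suc n)"
    by metis
  \<comment> \<open>At the midpoint the linear parts of \<open>q\<close> cancel, leaving the
    parallelogram law; the midpoint value is then bounded below by \<open>m\<close>.\<close>
  have par: "(norm (x - y))\<^sup>2 \<le> 2 * (q x - m) + 2 * (q y - m)" for x y
  proof -
    have "(norm (x - y))\<^sup>2 = 2 * q x + 2 * q y - 4 * q ((1/2) *\<^sub>R (x + y))"
      unfolding q_def power2_norm_eq_inner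
      by (simp add: f.add f.scale inner_add_left inner_add_right inner_diff_left
          inner_diff_right inner_commute algebra_simps)
    then show ?thesis
      using m_le [of "(1/2) *\<^sub>R (x + y)"] by simp
  qed
  have "Cauchy X"
  proof (rule metric_CauchyI)
    fix e :: real
    assume "0 < e"
    then obtain N where N: "1 / real (Suc N) < e\<^sup>2 / 4"
      using nat_approx_posE [of "e\<^sup>2 / 4"] by auto
    have small: "q (X n) - m < e\<^sup>2 / 4" if "n \<ge> N" for n
    proof -
      have "1 / real (Suc n) \<le> 1 / real (Suc N)"
        using that by (simp add: frac_le)
      then show ?thesis using X [of n] N by linarith
    qed
    show "\<exists>M. \<forall>m\<ge>M. \<forall>n\<ge>M. dist (X m) (X n) < e"
    proof (intro exI allI impI)
      fix i j
      assume "N \<le> i" "N \<le> j"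
      have "(norm (X i - X j))\<^sup>2 \<le> 2 * (q (X i) - m) + 2 * (q (X j) - m)"
        by (rule par)
      also have "\<dots> < 2 * (e\<^sup>2 / 4) + 2 * (e\<^sup>2 / 4)"
        using \<open>N \<le> i\<close> \<open>N \<le> j\<close> by (intro add_strict_mono mult_strict_left_mono small) auto
      finally have "(norm (X i - X j))\<^sup>2 < e\<^sup>2"
        by simp
      then show "dist (X i) (X j) < e"
        using \<open>0 < e\<close> by (simp add: dist_norm power2_less_imp_less)
    qed
  qed
  then obtain z where z: "X \<longlonglongrightarrow> z"
    using Cauchy_convergent_iff convergent_def by blast
  have "(\<lambda>n. q (X n)) \<longlonglongrightarrow> q z"
    unfolding q_def by (intro tendsto_intros z f.tendsto)
  moreover have "(\<lambda>n. m + 1 / real (Suc n)) \<longlonglongrightarrow> m + 0"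
    by (intro tendsto_intros LIMSEQ_Suc [OF lim_1_over_n])
  ultimately have "q z \<le> m"
    using LIMSEQ_le [of "\<lambda>n. q (X n)" "q z" "\<lambda>n. m + 1 / real (Suc n)" "m + 0"] X
    by (auto intro: less_imp_le)
  have "f h = inner z h" for h
  proof (cases "h = 0")
    case False
    define c where "c = inner z h - f h"
    \<comment> \<open>The minimiser of \<open>t * (t * (norm h)\<^sup>2 + 2 * c)\<close>, the
      increment of \<open>q\<close> from \<open>z\<close> in direction \<open>h\<close>; minimality
      of \<open>z\<close> then forces \<open>c = 0\<close>.\<close>
    define t where "t = - c / (norm h)\<^sup>2"
    have "0 \<le> q (z + t *\<^sub>R h) - q z"
      using \<open>q z \<le> m\<close> m_le [of "z + t *\<^sub>R h"] by simp
    also have "\<dots> = t * (t * (norm h)\<^sup>2 + 2 * c)"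
      unfolding q_def c_def power2_norm_eq_inner
      by (simp add: f.add f.scale inner_add_left inner_add_right inner_commute algebra_simps)
    also have "\<dots> = - c\<^sup>2 / (norm h)\<^sup>2"
      using False by (simp add: t_def power2_eq_square)
    finally have "c\<^sup>2 \<le> 0"
      using False by (simp add: divide_le_0_iff)
    then show ?thesis by (simp add: c_def)
  qed (simp add: f.zero)
  then show ?thesis by blast
qed

text \<open>Riesz gives a real adjoint \<open>g\<close>; since \<open>T\<close> commutes with
  \<open>\<i>\<close>, the imaginary parts agree as well, so \<open>g\<close> is also the adjoint
  for \<open>cinner\<close>.\<close>

lemma adjoint_exists:
  fixes T :: "'a::complex_hilbert_space \<Rightarrow>\<^sub>L 'a"
  assumes "complex_linear T"
  shows "\<exists>A :: 'a \<Rightarrow>\<^sub>L 'a. \<forall>x y. cinner (T x) y = cinner x (A y)"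
proof -
  have "\<exists>z. \<forall>x. inner (T x) y = inner z x" for y
    by (rule riesz_representation)
      (intro bounded_linear_compose [OF bounded_linear_inner_left] blinfun.bounded_linear_right)
  then obtain g where g: "\<And>x y. inner (T x) y = inner (g y) x"
    by metis
  have cg: "cinner (T x) y = cinner x (g y)" for x y
    using assms g [of x y] g [of "\<i> *\<^sub>C x" y]
    by (simp add: cinner_eq_inner complex_linear_def inner_commute)
  have "bounded_linear g"
  proof (rule bounded_linear_intro)
    show "g (x + y) = g x + g y" for x y
      by (rule cinner_eqI_right) (simp add: cinner_add_right flip: cg)
    show "g (r *\<^sub>R x) = r *\<^sub>R g x" for r x
      by (rule cinner_eqI_right) (simp add: cinner_scaleR_right flip: cg)
    show "norm (g y) \<le> norm y * norm T" for y
    proof (cases "g y = 0")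
      case False
      have "norm (g y) * norm (g y) = inner (T (g y)) y"
        by (simp add: g power2_norm_eq_inner flip: power2_eq_square)
      also have "\<dots> \<le> norm (T (g y)) * norm y"
        by (rule norm_cauchy_schwarz)
      also have "\<dots> \<le> (norm T * norm (g y)) * norm y"
        by (intro mult_right_mono norm_blinfun) simp
      finally have "norm (g y) * norm (g y) \<le> norm (g y) * (norm y * norm T)"
        by (simp add: mult_ac)
      then show ?thesis using False by simp
    qed simp
  qed
  then have "cinner (T x) y = cinner x (Blinfun g y)" for x y
    by (simp add: cg bounded_linear_Blinfun_apply)
  then show ?thesis by blast
qed

text \<open>Resolves the description in \<open>cadj\<close>: existence is
  \<open>adjoint_exists\<close>, and uniqueness holds because inner products separate
  vectors.\<close>

lemma cinner_cadj:
  fixes T :: "'a::complex_hilbert_space \<Rightarrow>\<^sub>L 'a"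
  assumes "complex_linear T"
  shows "cinner x (cadj T y) = cinner (T x) y"
proof -
  obtain A :: "'a \<Rightarrow>\<^sub>L 'a" where A: "\<forall>x y. cinner (T x) y = cinner x (A y)"
    using adjoint_exists [OF assms] by blast
  have "cadj T = A"
    unfolding cadj_def
  proof (rule the_equality)
    fix B :: "'a \<Rightarrow>\<^sub>L 'a"
    assume B: "\<forall>x y. cinner (T x) y = cinner x (B y)"
    have "cinner x (B y) = cinner x (A y)" for x y
      using A B by simp
    then show "B = A"
      by (metis blinfun_eqI cinner_eqI_right)
  qed (fact A)
  then show ?thesis
    using A by simp
qed

lemma cinner_cadj_left:
  fixes T :: "'a::complex_hilbert_space \<Rightarrow>\<^sub>L 'a"
  assumes "complex_linear T"
  shows "cinner (cadj T x) y = cinner x (T y)"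
  using cinner_cadj [OF assms] by (metis cinner_commute)

text \<open>Removes the adjoints, so that \<open>Delta2 T\<close> can be handled through a Hermitian
  form in \<open>T x\<close> and \<open>T (T x)\<close>.\<close>

lemma cinner_Delta2:
  fixes T :: "'a::complex_hilbert_space \<Rightarrow>\<^sub>L 'a"
  assumes "complex_linear T"
  shows "cinner (Delta2 T x) y = cinner x y - 2 * cinner (T x) (T y) + cinner (T (T x)) (T (T y))"
  by (simp add: Delta2_def blinfun.add_left blinfun.diff_left blinfun.scaleR_left cinner_add_left
      cinner_diff_left cinner_scaleR_left cinner_cadj_left assms)

lemma Delta2_selfadjoint:
  fixes T :: "'a::complex_hilbert_space \<Rightarrow>\<^sub>L 'a"
  assumes "complex_linear T"
  shows "cinner (Delta2 T x) y = cinner x (Delta2 T y)"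
proof -
  have "cinner x (Delta2 T y) = cnj (cinner (Delta2 T y) x)"
    by (rule cinner_commute)
  also have "\<dots> = cinner (Delta2 T x) y"
    by (simp add: cinner_Delta2 [OF assms] cinner_commute [symmetric])
  finally show ?thesis by simp
qed

section \<open>The rank-one perturbation\<close>

lemma op_ker_rank_one: "u \<noteq> 0 \<Longrightarrow> op_ker (rank_one u v) = {x. cinner x v = 0}"
  by (auto simp: op_ker_def rank_one.rep_eq) (metis norm_eq_zero norm_scaleC mult_eq_0_iff)

lemma cproj_unit_comp:
  fixes v x :: "'a::complex_inner"
  assumes "norm v = 1"
  shows "cproj {x. cinner x v = 0} x = x - cinner x v *\<^sub>C v"
  unfolding cproj_def
proof (rule the_equality)
  have vv: "cinner v v = 1"
    using assms by (simp add: cinner_self)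
  have v: "cinner v z = 0" if "cinner z v = 0" for z
    using that by (simp add: cinner_eq_0_commute)
  show "x - cinner x v *\<^sub>C v \<in> {x. cinner x v = 0} \<and>
      x - (x - cinner x v *\<^sub>C v) \<in> corth_comp {x. cinner x v = 0}"
    by (auto simp: corth_comp_def cinner_diff_left cinner_scaleC_left vv v)
  fix y
  assume y: "y \<in> {x. cinner x v = 0} \<and> x - y \<in> corth_comp {x. cinner x v = 0}"
  \<comment> \<open>The difference of the two candidates lies in the kernel, so it is orthogonal
    both to \<open>x - y\<close> and to \<open>v\<close>, hence to itself.\<close>
  let ?d = "x - cinner x v *\<^sub>C v - y"
  have d: "cinner ?d v = 0"
    using y by (simp add: cinner_diff_left cinner_scaleC_left vv)
  then have "cinner (x - y) ?d = 0"
    using y by (auto simp: corth_comp_def)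
  then have "cinner ?d ?d = 0"
    using v [OF d] by (simp add: cinner_diff_left cinner_scaleC_left)
  then show "y = x - cinner x v *\<^sub>C v" by simp
qed

lemma complex_linear_add_rank_one:
  "complex_linear T \<Longrightarrow> complex_linear (T + rank_one u v)"
  by (simp add: complex_linear_def blinfun.add_left rank_one.rep_eq cinner_scaleC_left
      scaleC_scaleC scaleC_add_right)

text \<open>For \<open>x\<close> orthogonal to \<open>v\<close> the perturbed operator maps
  \<open>x\<close> to \<open>T x\<close>, so \<open>K\<close> enters only at the second application,
  which gives \<open>T (T x) + cinner (T x) v *\<^sub>C u\<close>. The three summands are the
  resulting cross terms; the rest is the form of \<open>Delta2 T\<close>, which is zero.\<close>

lemma cinner_Delta2_on_ker:
  fixes T :: "'a::complex_hilbert_space \<Rightarrow>\<^sub>L 'a"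
  assumes T: "complex_linear T" and iso: "two_isometry T"
    and x: "cinner x v = 0" and y: "cinner y v = 0"
  shows "cinner (Delta2 (T + rank_one u v) x) y =
    cinner x (cadj T (cadj T u)) * cinner (cadj T v) y
    + cinner x (cadj T v) * cinner (cadj T (cadj T u)) y
    + of_real ((norm u)\<^sup>2) * cinner x (cadj T v) * cinner (cadj T v) y"
proof -
  have "cinner x y - 2 * cinner (T x) (T y) + cinner (T (T x)) (T (T y)) = 0"
    using iso by (simp add: two_isometry_def flip: cinner_Delta2 [OF T])
  moreover have "cnj (cinner (T y) v) = cinner v (T y)"
    by (metis cinner_commute)
  ultimately show ?thesis
    by (simp add: cinner_Delta2 complex_linear_add_rank_one T blinfun.add_left rank_one.rep_eq x y
        cinner_cadj cinner_cadj_left cinner_add_left cinner_add_right cinner_scaleC_left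
        cinner_scaleC_right cinner_self algebra_simps)
qed

theorem theorem1p1:
  fixes T K T' :: "'a::complex_hilbert_space \<Rightarrow>\<^sub>L 'a"
    and u v :: 'a
    and S :: "'a set"
  assumes "separable_space (euclidean :: 'a topology)"
    and "complex_linear T"
    and "two_isometry T"
    and "u \<noteq> 0" and "v \<noteq> 0" and "norm v = 1"
    and K: "K = rank_one u v"
    and S: "S = S_space T K"
    and T': "T' = T + K"
  shows
    "(two_isometry T' \<longleftrightarrow>
        v \<in> op_ker (Delta2 T') \<and>
        exactly_one
          (S = op_ker K)
          (Delta2 T' ` S \<subseteq> S \<and>
           corth_comp S \<inter> op_ker K \<noteq> {0} \<and>
           (norm u)\<^sup>2 = - 2 * (gamma_coeff T u v + Re (cinner u (T v)))))
     \<and> (S = op_ker K \<longleftrightarrow> T ` op_ker K \<subseteq> op_ker K)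
     \<and> (v \<in> op_ker (Delta2 T') \<longrightarrow>
         (Delta2 T' ` S \<subseteq> S \<longleftrightarrow>
          Delta2 T' ` (corth_comp S \<inter> op_ker K) \<subseteq> corth_comp S \<inter> op_ker K))"
proof -

  \<comment> \<open>Splitting \<open>ker K\<close> into \<open>S\<close> and the span of
    \<open>w0\<close>\<close>
  note T = \<open>complex_linear T\<close>
  define D where "D = Delta2 T'"
  define w where "w = cadj T v"
  define w0 where "w0 = w - cinner w v *\<^sub>C v"
  define a where "a = cadj T (cadj T u)"
  have vv: "cinner v v = 1"
    using \<open>norm v = 1\<close> by (simp add: cinner_self)
  have kerK: "op_ker K = {x. cinner x v = 0}"
    using K \<open>u \<noteq> 0\<close> by (simp add: op_ker_rank_one)
  have w0v: "cinner w0 v = 0"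
    by (simp add: w0_def cinner_diff_left cinner_scaleC_left vv)
  \<comment> \<open>Vectors of \<open>ker K\<close> do not see the \<open>v\<close>-component of
    \<open>w\<close>.\<close>
  have xw: "cinner x w = cinner x w0" if "cinner x v = 0" for x
    by (simp add: w0_def cinner_diff_right cinner_scaleC_right that)
  have wx: "cinner w x = cinner w0 x" if "cinner x v = 0" for x
    using xw [OF that] by (metis cinner_commute)
  have S_iff: "x \<in> S \<longleftrightarrow> cinner x v = 0 \<and> cinner x w0 = 0" for x
  proof -
    have "cinner (T x) v = cinner x w"
      by (simp add: w_def cinner_cadj [OF T])
    then show ?thesis
      using xw [of x] by (auto simp: S S_space_def kerK)
  qed
  have D_sym: "cinner (D x) y = cinner x (D y)" for x y
    unfolding D_def T' K by (intro Delta2_selfadjoint complex_linear_add_rank_one T)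
  have D_ker: "cinner (D x) y = cinner x a * cinner w0 y + cinner x w0 * cinner a y
      + of_real ((norm u)\<^sup>2) * cinner x w0 * cinner w0 y"
    if "cinner x v = 0" "cinner y v = 0" for x y
    using cinner_Delta2_on_ker [OF T \<open>two_isometry T\<close> that, of u] that
    by (simp add: D_def T' K xw wx a_def flip: w_def)
  have decomp: "\<exists>c s. s \<in> S \<and> x = s + c *\<^sub>C w0" if "cinner x v = 0" for x
  proof (intro exI conjI)
    \<comment> \<open>The projection coefficient along \<open>w0\<close>. If \<open>w0 = 0\<close>,
      division by zero makes it 0, and \<open>x\<close> itself lies in \<open>S\<close>.\<close>
    let ?c = "cinner x w0 / cinner w0 w0"
    show "x - ?c *\<^sub>C w0 \<in> S"
      using that by (cases "w0 = 0") (simp_all add: S_iff cinner_diff_left cinner_scaleC_left w0v)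
    show "x = x - ?c *\<^sub>C w0 + ?c *\<^sub>C w0" by simp
  qed
  have comp_ker: "x \<in> corth_comp S \<inter> op_ker K \<longleftrightarrow> (\<exists>c. x = c *\<^sub>C w0)" for x
  proof
    assume x: "x \<in> corth_comp S \<inter> op_ker K"
    then obtain c d where d: "d \<in> S" "x = d + c *\<^sub>C w0"
      using decomp kerK by blast
    \<comment> \<open>The \<open>S\<close>-part \<open>d\<close> is orthogonal to \<open>x\<close>
      and to \<open>w0\<close>, hence to itself.\<close>
    then have "cinner x d = 0"
      using x by (simp add: corth_comp_def)
    then have "cinner d d = 0"
      using d cinner_eq_0_commute [of d w0]
      by (simp add: S_iff cinner_add_left cinner_scaleC_left)
    then show "\<exists>c. x = c *\<^sub>C w0"
      using d by auto
  next
    assume "\<exists>c. x = c *\<^sub>C w0"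
    then show "x \<in> corth_comp S \<inter> op_ker K"
      using w0v by (auto simp: corth_comp_def kerK S_iff cinner_scaleC_left cinner_eq_0_commute [of w0])
  qed
  have w0_in: "w0 \<in> corth_comp S \<inter> op_ker K"
    using comp_ker scaleC_one by metis
  have comp_trivial: "corth_comp S \<inter> op_ker K = {0} \<longleftrightarrow> w0 = 0"
  proof
    assume "w0 = 0"
    moreover have "c *\<^sub>C 0 = (0::'a)" for c
      by (metis mult_zero_right norm_eq_zero norm_scaleC norm_zero)
    ultimately show "corth_comp S \<inter> op_ker K = {0}"
      using comp_ker by auto
  qed (use w0_in in auto)
  have S_ker: "S = op_ker K \<longleftrightarrow> w0 = 0"
  proof
    assume "S = op_ker K"
    then have "w0 \<in> S" using w0_in by simp
    then show "w0 = 0" by (simp add: S_iff)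
  next
    assume "w0 = 0"
    then show "S = op_ker K" by (auto simp: S_iff kerK)
  qed

  \<comment> \<open>Invariance of \<open>ker K\<close> under \<open>T\<close>, and of
    \<open>S\<close> under \<open>D\<close>\<close>
  have inv: "S = op_ker K \<longleftrightarrow> T ` op_ker K \<subseteq> op_ker K"
    by (auto simp: S S_space_def)
  \<comment> \<open>By symmetry \<open>D v = 0\<close> keeps the range of \<open>D\<close>
    orthogonal to \<open>v\<close>, so membership in \<open>S\<close> only asks for orthogonality to
    \<open>w0\<close>.\<close>
  have D_S: "D ` S \<subseteq> S \<longleftrightarrow> (\<forall>x\<in>S. cinner (D x) w0 = 0)" if "D v = 0"
    using D_sym that by (auto simp: S_iff)
  have equiv: "D ` S \<subseteq> S \<longleftrightarrow> D ` (corth_comp S \<inter> op_ker K) \<subseteq> corth_comp S \<inter> op_ker K"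
    if "D v = 0"
  proof
    assume "D ` S \<subseteq> S"
    then show "D ` (corth_comp S \<inter> op_ker K) \<subseteq> corth_comp S \<inter> op_ker K"
      using that D_sym by (auto simp: corth_comp_def kerK)
  next
    assume "D ` (corth_comp S \<inter> op_ker K) \<subseteq> corth_comp S \<inter> op_ker K"
    then have "D w0 \<in> corth_comp S"
      using w0_in by blast
    then show "D ` S \<subseteq> S"
      by (auto simp: D_S [OF that] corth_comp_def D_sym cinner_eq_0_commute [of _ "D w0"])
  qed

  \<comment> \<open>The coefficient \<open>\<gamma>\<close> and the value of the form at
    \<open>w0\<close>\<close>
  have gamma: "gamma_coeff T u v + Re (cinner u (T v)) = Re (cinner a w0) / (norm w0)\<^sup>2"
    if "w0 \<noteq> 0"
  proof -
    have quot: "Re (cinner (cadj T (cproj (op_ker K) (cadj T u))) x / cinner w x)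
        = Re (cinner a w0) / (norm w0)\<^sup>2 - Re (cinner u (T v))"
      if x: "x \<in> (corth_comp S \<inter> op_ker K) - {0}" for x
    proof -
      obtain c where c: "x = c *\<^sub>C w0"
        using x comp_ker [of x] by auto
      have "c \<noteq> 0"
        using x c by (metis DiffD2 insertI1 scaleC_zero_left)
      \<comment> \<open>Projecting subtracts \<open>cinner (cadj T u) v *\<^sub>C v\<close>, whose
        coefficient is \<open>cinner u (T v)\<close>. After division this is the term that cancels
        in \<open>gamma\<close>, while the scalar \<open>c\<close> drops out of the
        quotient.\<close>
      have "cinner (cadj T (cproj (op_ker K) (cadj T u))) x
          = cinner a x - cinner u (T v) * cinner w x"
        by (simp add: kerK cproj_unit_comp \<open>norm v = 1\<close> cinner_cadj_left [OF T] cinner_diff_left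
            cinner_scaleC_left a_def w_def)
      moreover have "cinner w x = cnj c * of_real ((norm w0)\<^sup>2)"
        using x kerK by (simp add: wx) (simp add: c cinner_scaleC_right cinner_self)
      moreover have "cinner a x = cnj c * cinner a w0"
        by (simp add: c cinner_scaleC_right)
      ultimately have "cinner (cadj T (cproj (op_ker K) (cadj T u))) x / cinner w x
          = (cnj c * cinner a w0 - cinner u (T v) * (cnj c * of_real ((norm w0)\<^sup>2)))
            / (cnj c * of_real ((norm w0)\<^sup>2))"
        by (simp only:)
      also have "\<dots> = cinner a w0 / of_real ((norm w0)\<^sup>2) - cinner u (T v)"
        using \<open>c \<noteq> 0\<close> \<open>w0 \<noteq> 0\<close> by (simp add: diff_divide_distrib)
      finally show ?thesis
        by (simp only: minus_complex.sel Re_divide_of_real)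
    qed
    have "gamma_coeff T u v = Re (cinner a w0) / (norm w0)\<^sup>2 - Re (cinner u (T v))"
      unfolding gamma_coeff_def Let_def K [symmetric] S [symmetric] w_def [symmetric]
    proof (rule the_equality)
      fix r
      assume "\<forall>x\<in>(corth_comp S \<inter> op_ker K) - {0}.
        r = Re (cinner (cadj T (cproj (op_ker K) (cadj T u))) x / cinner w x)"
      \<comment> \<open>\<open>w0\<close> is itself admissible, so the quantified condition is not
        vacuous and determines \<open>r\<close>.\<close>
      then show "r = Re (cinner a w0) / (norm w0)\<^sup>2 - Re (cinner u (T v))"
        using quot [of w0] w0_in \<open>w0 \<noteq> 0\<close> by (metis DiffI empty_iff insert_iff)
    qed (simp add: quot)
    then show ?thesis by simp
  qed
  \<comment> \<open>By \<open>D_ker\<close> the value at \<open>(w0, w0)\<close> is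
    \<open>(norm w0)\<^sup>2\<close> times a bracket; dividing the bracket by
    \<open>(norm w0)\<^sup>2\<close> and inserting \<open>gamma\<close> gives the norm
    identity.\<close>
  have D_w0: "(norm u)\<^sup>2 = - 2 * (gamma_coeff T u v + Re (cinner u (T v)))
      \<longleftrightarrow> cinner (D w0) w0 = 0" if "w0 \<noteq> 0"
  proof -
    have "cinner (D w0) w0 = of_real ((norm w0)\<^sup>2) * (cinner a w0 + cnj (cinner a w0))
        + of_real ((norm u)\<^sup>2 * ((norm w0)\<^sup>2)\<^sup>2)"
      using w0v cinner_commute [of w0 a]
      by (simp add: D_ker cinner_self power2_eq_square algebra_simps)
    also have "\<dots> = of_real ((norm w0)\<^sup>2 * (2 * Re (cinner a w0) + (norm u)\<^sup>2 * (norm w0)\<^sup>2))"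
      by (simp add: complex_add_cnj power2_eq_square algebra_simps)
    finally have "cinner (D w0) w0 = 0 \<longleftrightarrow> 2 * Re (cinner a w0) + (norm u)\<^sup>2 * (norm w0)\<^sup>2 = 0"
      using that by (simp only: of_real_eq_0_iff mult_eq_0_iff) simp
    then show ?thesis
      unfolding gamma [OF that] using that by (auto simp: field_simps)
  qed

  \<comment> \<open>Vanishing of \<open>D\<close>\<close>
  have D_zero: "D = 0" if Dv: "D v = 0" and DS: "\<forall>x\<in>S. cinner (D x) w0 = 0"
    and Dw: "cinner (D w0) w0 = 0"
  proof (rule blinfun_eqI)
    have form: "cinner (D x) y = 0" if x: "cinner x v = 0" and y: "cinner y v = 0" for x y
    proof -
      obtain c s where s: "s \<in> S" "x = s + c *\<^sub>C w0"
        using decomp [OF x] by blast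
      obtain d t where t: "t \<in> S" "y = t + d *\<^sub>C w0"
        using decomp [OF y] by blast
      \<comment> \<open>Every term of \<open>D_ker\<close> has a factor pairing \<open>w0\<close>
        with \<open>s\<close> or \<open>t\<close>.\<close>
      have "cinner (D s) t = 0"
        using s(1) t(1) by (simp add: D_ker S_iff cinner_eq_0_commute [of w0])
      moreover have "cinner (D w0) t = 0"
        using DS t(1) D_sym cinner_eq_0_commute by metis
      moreover have "cinner (D s) w0 = 0"
        using DS s(1) by blast
      moreover have "cinner (D (c *\<^sub>C w0)) z = c * cinner (D w0) z" for z
        by (simp add: D_sym cinner_scaleC_left)
      ultimately show ?thesis
        using Dw by (simp add: s(2) t(2) blinfun.add_right cinner_add_left cinner_add_right
            cinner_scaleC_right)
    qed
    \<comment> \<open>The range of \<open>D\<close> lies in \<open>ker K\<close>. Testing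
      \<open>form\<close> against \<open>D x\<close> shows that \<open>D\<close> kills
      \<open>ker K\<close>, so \<open>D (D x) = 0\<close> for all \<open>x\<close>, and symmetry
      gives \<open>D x = 0\<close>.\<close>
    have D_v: "cinner (D x) v = 0" for x
      by (simp add: D_sym Dv)
    have "D x = 0" if "cinner x v = 0" for x
      using form [OF that D_v, of x] by simp
    then have "D (D x) = 0" for x
      using D_v by blast
    then show "D x = blinfun_apply 0 x" for x
      using D_sym [of x "D x"] by simp
  qed
  have D_iff: "D = 0 \<longleftrightarrow> D v = 0 \<and> (\<forall>x\<in>S. cinner (D x) w0 = 0) \<and> cinner (D w0) w0 = 0"
    using D_zero by (metis blinfun.zero_left cinner_zero_left)
  have main: "two_isometry T' \<longleftrightarrow> D v = 0 \<and> exactly_one (S = op_ker K)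
          (D ` S \<subseteq> S \<and> corth_comp S \<inter> op_ker K \<noteq> {0} \<and>
           (norm u)\<^sup>2 = - 2 * (gamma_coeff T u v + Re (cinner u (T v))))"
  \<comment> \<open>The split settles \<open>exactly_one\<close>: for \<open>w0 = 0\<close>
    condition (i) holds and (ii) fails, leaving only \<open>D v = 0\<close>; otherwise (i) fails and
    (ii) supplies the other two conditions of \<open>D_iff\<close>.\<close>
  proof (cases "w0 = 0")
    case True
    then have "D = 0 \<longleftrightarrow> D v = 0"
      using D_iff by (metis cinner_zero_right)
    moreover have "S = op_ker K" "corth_comp S \<inter> op_ker K = {0}"
      using True S_ker comp_trivial by blast+
    ultimately show ?thesis
      unfolding two_isometry_def D_def [symmetric] exactly_one_def by blast
  next
    case False
    then have "S \<noteq> op_ker K" "corth_comp S \<inter> op_ker K \<noteq> {0}"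
      using S_ker comp_trivial by blast+
    then show ?thesis
      unfolding two_isometry_def D_def [symmetric] exactly_one_def D_w0 [OF False]
      using D_iff D_S by blast
  qed
  show ?thesis
    using main inv equiv unfolding op_ker_def [of "Delta2 T'"] mem_Collect_eq D_def by blast
qed

end
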